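(* Let $\phi:\mathcal{G}\to\mathcal{G}'$ be a strong groupoid homomorphism. Then: (i) If $\mathcal{H}<\mathcal{G}$, then $\phi(\mathcal{H})<\mathcal{G}'$ and $\mathrm{Ker}(\phi)\mathcal{H}=\phi^{-1}(\phi(\mathcal{H}))$. In particular, $\mathrm{Im}(\phi)=\phi(\mathcal{G})$ and $\mathrm{Ker}(\phi)\mathcal{H}$ are subgroupoids of $\mathcal{G}'$ and $\mathcal{G}$, respectively. (ii) If $\mathcal{H}\lhd\mathcal{G}$, then $\phi(\mathcal{H})\lhd\phi(\mathcal{G})$. (iii) $\phi$ is an injective homomorphism if and only if $\mathrm{Ker}(\phi)=\mathcal{G}_0$. (iv) (The Correspondence Theorem for Groupoids) There exists a one-to-one correspondence between the sets $\mathfrak{A}=\{\mathcal{H}\mid\mathcal{H}<\mathcal{G}\text{ and }\mathrm{Ker}(\phi)\subseteq\mathcal{H}\}$ and $\mathfrak{B}=\{\mathcal{H}'\mid\mathcal{H}'<\phi(\mathcal{G})\}$. Moreover, this correspondence preserves normal subgroupoids.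
   Context: A groupoid is a set $\mathcal{G}$ with a partial binary operation, written by concatenation ($\exists gh$ means that $gh$ is defined). An element $e$ is an identity if $\exists eg$ implies $eg=g$ and $\exists g'e$ implies $g'e=g'$; $\mathcal{G}_0$ is the set of identities. Axioms: (i) $\exists g(hl)$ iff $\exists (gh)l$, and then $g(hl)=(gh)l$; (ii) $\exists g(hl)$ iff $\exists gh$ and $\exists hl$; (iii) for each $g$ there are unique identities $d(g),r(g)$ with $\exists gd(g)$ and $\exists r(g)g$; (iv) for each $g$ there is $g^{-1}$ with $\exists g^{-1}g$, $\exists gg^{-1}$, $d(g)=g^{-1}g$, $r(g)=gg^{-1}$. (Thus $\exists gh$ iff $d(g)=r(h)$.) For $e\in\mathcal{G}_0$, $\mathcal{G}_e=\{g\in\mathcal{G}\mid d(g)=r(g)=e\}$. $\mathcal{H}<\mathcal{G}$ means that $\mathcal{H}$ is a subgroupoid of $\mathcal{G}$, that is, a nonempty (not necessarily proper) subset closed under inverses and under defined products; it is wide if it has the same set of identities as $\mathcal{G}$. $\mathcal{H}\mathcal{K}=\{hk\mid h\in\mathcal{H},k\in\mathcal{K},\exists hk\}$. A subgroupoid $\mathcal{H}$ of $\mathcal{G}$ is normal, $\mathcal{H}\lhd\mathcal{G}$, if for all $g\in\mathcal{G}$ the set $g^{-1}\mathcal{H}g=\{g^{-1}hg\mid h\in\mathcal{H}\cap\mathcal{G}_{r(g)}\}$ is nonempty and contained in $\mathcal{H}$ (nonemptiness for all $g$ is equivalent to $\mathcal{H}$ being wide). A groupoid homomorphism $\phi:\mathcal{G}\to\mathcal{G}'$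 is a map between groupoids such that $\exists xy$ implies $\exists\phi(x)\phi(y)$ and $\phi(xy)=\phi(x)\phi(y)$. It is strong if, for all $x,y\in\mathcal{G}$, $\exists\phi(x)\phi(y)$ implies $\exists xy$. $\mathrm{Ker}(\phi)=\{g\in\mathcal{G}\mid\phi(g)\in\mathcal{G}'_0\}$; $\phi(\mathcal{H})$ and $\phi^{-1}(\mathcal{H}')$ denote direct and inverse images.
   Formalization: In (iv), the set B is restricted to wide subgroupoids of φ(G), since the claim fails for all subgroupoids (identity map of the discrete groupoid on two points: A has 1 element, B has 3); in (i), Im(φ) being a subgroupoid is stated for nonempty G. *)

theory Defs
  imports "HOL-Algebra.Congruence"
begin

text \<open>
  The partial product is option-valued: \<open>pmult G g h = Some x\<close> says that \<open>gh\<close> is defined and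
  equals \<open>x\<close>.  Only its values on \<open>carrier G\<close> matter, so a subset \<open>S\<close> carries the partial
  operation of \<open>G\<close> as the record \<open>G\<lparr>carrier := S\<rparr>\<close>.
\<close>

record 'a pmagma = "'a partial_object" +
  pmult :: "'a \<Rightarrow> 'a \<Rightarrow> 'a option"

definition pdefined :: "('a, 'm) pmagma_scheme \<Rightarrow> 'a \<Rightarrow> 'a \<Rightarrow> bool" where
  "pdefined G g h \<longleftrightarrow> pmult G g h \<noteq> None"

definition mult_right3 :: "('a, 'm) pmagma_scheme \<Rightarrow> 'a \<Rightarrow> 'a \<Rightarrow> 'a \<Rightarrow> 'a option" where
  "mult_right3 G g h l = Option.bind (pmult G h l) (\<lambda>x. pmult G g x)"

definition mult_left3 :: "('a, 'm) pmagma_scheme \<Rightarrow> 'a \<Rightarrow> 'a \<Rightarrow> 'a \<Rightarrow> 'a option" where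
  "mult_left3 G g h l = Option.bind (pmult G g h) (\<lambda>x. pmult G x l)"

definition identities :: "('a, 'm) pmagma_scheme \<Rightarrow> 'a set" where
  "identities G = {e \<in> carrier G. \<forall>g\<in>carrier G.
     (pdefined G e g \<longrightarrow> pmult G e g = Some g) \<and> (pdefined G g e \<longrightarrow> pmult G g e = Some g)}"

definition dom_id :: "('a, 'm) pmagma_scheme \<Rightarrow> 'a \<Rightarrow> 'a" where
  "dom_id G g = (THE e. e \<in> identities G \<and> pdefined G g e)"

definition ran_id :: "('a, 'm) pmagma_scheme \<Rightarrow> 'a \<Rightarrow> 'a" where
  "ran_id G g = (THE e. e \<in> identities G \<and> pdefined G e g)"

definition is_inverse :: "('a, 'm) pmagma_scheme \<Rightarrow> 'a \<Rightarrow> 'a \<Rightarrow> bool" where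
  "is_inverse G g g' \<longleftrightarrow> g' \<in> carrier G \<and>
     pmult G g' g = Some (dom_id G g) \<and> pmult G g g' = Some (ran_id G g)"

text \<open>
  In \<open>assoc\<close>, equality of options expresses both that one side is defined iff the other is,
  and that the two values then agree.
\<close>

locale groupoid =
  fixes G :: "('a, 'm) pmagma_scheme"
  assumes closed:
      "\<lbrakk>g \<in> carrier G; h \<in> carrier G; pmult G g h = Some x\<rbrakk> \<Longrightarrow> x \<in> carrier G"
    and assoc:
      "\<lbrakk>g \<in> carrier G; h \<in> carrier G; l \<in> carrier G\<rbrakk> \<Longrightarrow>
         mult_right3 G g h l = mult_left3 G g h l"
    and defined3:
      "\<lbrakk>g \<in> carrier G; h \<in> carrier G; l \<in> carrier G\<rbrakk> \<Longrightarrow>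
         mult_right3 G g h l \<noteq> None \<longleftrightarrow> pdefined G g h \<and> pdefined G h l"
    and ex1_dom:
      "g \<in> carrier G \<Longrightarrow> \<exists>!e. e \<in> identities G \<and> pdefined G g e"
    and ex1_ran:
      "g \<in> carrier G \<Longrightarrow> \<exists>!e. e \<in> identities G \<and> pdefined G e g"
    and ex_inverse:
      "g \<in> carrier G \<Longrightarrow> \<exists>g'. is_inverse G g g'"

definition inv_elt :: "('a, 'm) pmagma_scheme \<Rightarrow> 'a \<Rightarrow> 'a" where
  "inv_elt G g = (THE g'. is_inverse G g g')"

definition isotropy :: "('a, 'm) pmagma_scheme \<Rightarrow> 'a \<Rightarrow> 'a set" where
  "isotropy G e = {g \<in> carrier G. dom_id G g = e \<and> ran_id G g = e}"

definition subgroupoid :: "'a set \<Rightarrow> ('a, 'm) pmagma_scheme \<Rightarrow> bool" where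
  "subgroupoid H G \<longleftrightarrow> H \<subseteq> carrier G \<and> H \<noteq> {} \<and>
     (\<forall>h\<in>H. inv_elt G h \<in> H) \<and>
     (\<forall>h\<in>H. \<forall>k\<in>H. \<forall>x. pmult G h k = Some x \<longrightarrow> x \<in> H)"

text \<open>
  Wideness is needed in the correspondence theorem: a subgroupoid containing the kernel of a
  homomorphism contains all identities, so its image is wide in the image groupoid.  For the
  identity map of the discrete groupoid on two points, the only subgroupoid containing the
  kernel is the whole groupoid, which however has three subgroupoids, one of them wide.
\<close>

definition wide_subgroupoid :: "'a set \<Rightarrow> ('a, 'm) pmagma_scheme \<Rightarrow> bool" where
  "wide_subgroupoid H G \<longleftrightarrow> subgroupoid H G \<and> identities (G\<lparr>carrier := H\<rparr>) = identities G"

definition set_prod :: "('a, 'm) pmagma_scheme \<Rightarrow> 'a set \<Rightarrow> 'a set \<Rightarrow> 'a set" where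
  "set_prod G H K = {x. \<exists>h\<in>H. \<exists>k\<in>K. pmult G h k = Some x}"

definition conjugate_set :: "('a, 'm) pmagma_scheme \<Rightarrow> 'a \<Rightarrow> 'a set \<Rightarrow> 'a set" where
  "conjugate_set G g H =
     {x. \<exists>h \<in> H \<inter> isotropy G (ran_id G g). mult_left3 G (inv_elt G g) h g = Some x}"

definition normal_subgroupoid :: "'a set \<Rightarrow> ('a, 'm) pmagma_scheme \<Rightarrow> bool" where
  "normal_subgroupoid H G \<longleftrightarrow> subgroupoid H G \<and>
     (\<forall>g\<in>carrier G. conjugate_set G g H \<noteq> {} \<and> conjugate_set G g H \<subseteq> H)"

definition groupoid_hom ::
    "('a, 'm) pmagma_scheme \<Rightarrow> ('b, 'n) pmagma_scheme \<Rightarrow> ('a \<Rightarrow> 'b) \<Rightarrow> bool" where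
  "groupoid_hom G G' \<phi> \<longleftrightarrow> \<phi> \<in> carrier G \<rightarrow> carrier G' \<and>
     (\<forall>x\<in>carrier G. \<forall>y\<in>carrier G. \<forall>z.
        pmult G x y = Some z \<longrightarrow> pmult G' (\<phi> x) (\<phi> y) = Some (\<phi> z))"

definition strong_hom ::
    "('a, 'm) pmagma_scheme \<Rightarrow> ('b, 'n) pmagma_scheme \<Rightarrow> ('a \<Rightarrow> 'b) \<Rightarrow> bool" where
  "strong_hom G G' \<phi> \<longleftrightarrow> groupoid_hom G G' \<phi> \<and>
     (\<forall>x\<in>carrier G. \<forall>y\<in>carrier G. pdefined G' (\<phi> x) (\<phi> y) \<longrightarrow> pdefined G x y)"

definition Ker :: "('a, 'm) pmagma_scheme \<Rightarrow> ('b, 'n) pmagma_scheme \<Rightarrow> ('a \<Rightarrow> 'b) \<Rightarrow> 'a set" where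
  "Ker G G' \<phi> = {g \<in> carrier G. \<phi> g \<in> identities G'}"

definition inverse_image :: "('a, 'm) pmagma_scheme \<Rightarrow> ('a \<Rightarrow> 'b) \<Rightarrow> 'b set \<Rightarrow> 'a set" where
  "inverse_image G \<phi> H' = {g \<in> carrier G. \<phi> g \<in> H'}"

definition image_groupoid ::
    "('a, 'm) pmagma_scheme \<Rightarrow> ('b, 'n) pmagma_scheme \<Rightarrow> ('a \<Rightarrow> 'b) \<Rightarrow> ('b, 'n) pmagma_scheme" where
  "image_groupoid G G' \<phi> = G'\<lparr>carrier := \<phi> ` carrier G\<rparr>"

end

theory Submission
  imports Defs
begin

text \<open>
  For a strong homomorphism \<open>\<phi>\<close>, a product \<open>\<phi> x \<phi> y\<close> is defined only when \<open>x y\<close> is; equivalently,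
  \<open>\<phi>\<close> is injective on identities.  Two elements with the same image therefore behave as two
  elements of a group with the same image under a group homomorphism: if \<open>\<phi> g = \<phi> h\<close>, then
  \<open>g h\<^sup>-\<^sup>1\<close> exists and lies in the kernel, so that \<open>g = (g h\<^sup>-\<^sup>1) h\<close>.  This is the one idea of the
  proof.  It identifies \<open>Ker(\<phi>) H\<close> with the saturation \<open>\<phi>\<^sup>-\<^sup>1(\<phi>(H))\<close>
  (\<open>Ker_prod_eq_inverse_image\<close>), it gives injectivity when the kernel consists of identities
  (\<open>inj_iff_Ker\<close>), and it shows that a subgroupoid containing the kernel is saturated
  (\<open>inverse_image_image\<close>), whence it is recovered from its image.

  For the statements about \<open>\<phi>(G)\<close> the target is replaced by the image: a subgroupoid is a groupoid
  whose identities, domains, ranges and inverses are those of the ambient groupoid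
  (\<open>groupoid_restrict\<close>), so \<open>\<phi>\<close> is a surjective strong homomorphism onto its image, with the same
  kernel.  In the surjective case a subgroupoid containing the kernel has an image containing every
  identity, and conversely the preimage of a wide subgroupoid contains the kernel; this is
  the correspondence.  It preserves normality in both directions because forming conjugates
  commutes with taking images (\<open>image_conjugate_set\<close>).
\<close>

section \<open>Arithmetic in a groupoid\<close>

lemma identities_carrier: "e \<in> identities G \<Longrightarrow> e \<in> carrier G"
  by (simp add: identities_def)

lemma pdefinedI: "pmult G g h = Some x \<Longrightarrow> pdefined G g h"
  by (simp add: pdefined_def)

lemma pmult_identity_left:
  "\<lbrakk>e \<in> identities G; g \<in> carrier G; pdefined G e g\<rbrakk> \<Longrightarrow> pmult G e g = Some g"
  by (simp add: identities_def)

lemma pmult_identity_right: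
  "\<lbrakk>e \<in> identities G; g \<in> carrier G; pdefined G g e\<rbrakk> \<Longrightarrow> pmult G g e = Some g"
  by (simp add: identities_def)

lemma subgroupoid_subset: "subgroupoid S G \<Longrightarrow> S \<subseteq> carrier G"
  by (simp add: subgroupoid_def)

lemma subgroupoid_nonempty: "subgroupoid S G \<Longrightarrow> S \<noteq> {}"
  by (simp add: subgroupoid_def)

lemma subgroupoid_pmult:
  "\<lbrakk>subgroupoid S G; g \<in> S; h \<in> S; pmult G g h = Some x\<rbrakk> \<Longrightarrow> x \<in> S"
  unfolding subgroupoid_def by blast

lemma subgroupoid_inv_elt: "\<lbrakk>subgroupoid S G; g \<in> S\<rbrakk> \<Longrightarrow> inv_elt G g \<in> S"
  unfolding subgroupoid_def by blast

context groupoid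
begin

lemma dom_id_props:
  assumes "g \<in> carrier G"
  shows "dom_id G g \<in> identities G" "pmult G g (dom_id G g) = Some g"
proof -
  have "dom_id G g \<in> identities G \<and> pdefined G g (dom_id G g)"
    unfolding dom_id_def by (rule theI'[OF ex1_dom[OF assms]])
  then show "dom_id G g \<in> identities G" "pmult G g (dom_id G g) = Some g"
    using pmult_identity_right[OF _ assms] by simp_all
qed

lemma ran_id_props:
  assumes "g \<in> carrier G"
  shows "ran_id G g \<in> identities G" "pmult G (ran_id G g) g = Some g"
proof -
  have "ran_id G g \<in> identities G \<and> pdefined G (ran_id G g) g"
    unfolding ran_id_def by (rule theI'[OF ex1_ran[OF assms]])
  then show "ran_id G g \<in> identities G" "pmult G (ran_id G g) g = Some g"
    using pmult_identity_left[OF _ assms] by simp_all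
qed

lemma dom_id_eqI:
  "\<lbrakk>g \<in> carrier G; e \<in> identities G; pdefined G g e\<rbrakk> \<Longrightarrow> dom_id G g = e"
  using ex1_dom[of g] dom_id_props[of g] pdefinedI[of G g "dom_id G g"] by blast

lemma ran_id_eqI:
  "\<lbrakk>g \<in> carrier G; e \<in> identities G; pdefined G e g\<rbrakk> \<Longrightarrow> ran_id G g = e"
  using ex1_ran[of g] ran_id_props[of g] pdefinedI[of G "ran_id G g" g] by blast

lemma pmult_assoc:
  assumes "g \<in> carrier G" "h \<in> carrier G" "l \<in> carrier G"
    and "pmult G g h = Some x" "pmult G h l = Some y"
  obtains z where "pmult G g y = Some z" "pmult G x l = Some z"
proof -
  have "mult_right3 G g h l \<noteq> None"
    using defined3 assms pdefinedI by metis
  then show thesis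
    using assoc[OF assms(1-3)] assms(4,5) that
    by (auto simp: mult_right3_def mult_left3_def)
qed

lemma pdefined_iff:
  assumes "g \<in> carrier G" "h \<in> carrier G"
  shows "pdefined G g h \<longleftrightarrow> dom_id G g = ran_id G h"
proof
  assume "pdefined G g h"
  \<comment> \<open>Write \<open>g h\<close> as \<open>(g d(g)) h\<close>; then \<open>d(g) h\<close> is defined, so \<open>d(g)\<close> is the range of \<open>h\<close>.\<close>
  then have "mult_left3 G g (dom_id G g) h \<noteq> None"
    using dom_id_props[OF assms(1)] by (simp add: mult_left3_def pdefined_def)
  moreover have "dom_id G g \<in> carrier G"
    using dom_id_props[OF assms(1)] identities_carrier by metis
  ultimately have "pdefined G (dom_id G g) h"
    using assoc defined3 assms by metis
  then show "dom_id G g = ran_id G h"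
    using ran_id_eqI[OF assms(2)] dom_id_props[OF assms(1)] by simp
next
  assume eq: "dom_id G g = ran_id G h"
  have "dom_id G g \<in> carrier G"
    using dom_id_props[OF assms(1)] identities_carrier by metis
  then obtain z where "pmult G g h = Some z"
    using pmult_assoc[of g "dom_id G g" h g h] dom_id_props[OF assms(1)]
      ran_id_props[OF assms(2)] eq assms by metis
  then show "pdefined G g h" by (rule pdefinedI)
qed

text \<open>
  Evaluate \<open>g' g g''\<close> in the two possible ways.  Asking only that \<open>g g''\<close> be some identity, rather
  than \<open>r(g)\<close>, makes the lemma directly applicable to the image of \<open>g g\<^sup>-\<^sup>1\<close> under a homomorphism.
\<close>

lemma inverse_unique:
  assumes "g \<in> carrier G" and inv: "is_inverse G g g'"
    and "g'' \<in> carrier G" "pmult G g g'' = Some e" "e \<in> identities G"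
  shows "g'' = g'"
proof -
  have g': "g' \<in> carrier G" "pmult G g' g = Some (dom_id G g)"
    using inv by (auto simp: is_inverse_def)
  obtain z where z: "pmult G g' e = Some z" "pmult G (dom_id G g) g'' = Some z"
    using pmult_assoc[OF g'(1) assms(1,3) g'(2) assms(4)] by metis
  have "z = g'"
    using pmult_identity_right[OF assms(5) g'(1)] z(1) pdefinedI by fastforce
  moreover have "z = g''"
    using pmult_identity_left[OF dom_id_props(1)[OF assms(1)] assms(3)] z(2) pdefinedI
    by fastforce
  ultimately show ?thesis by simp
qed

lemma is_inverse_inv_elt:
  assumes "g \<in> carrier G" shows "is_inverse G g (inv_elt G g)"
  unfolding inv_elt_def
proof (rule theI')
  have "g'' = g'" if "is_inverse G g g'" "is_inverse G g g''" for g' g''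
    using inverse_unique[OF assms that(1)] that(2) ran_id_props(1)[OF assms]
    by (auto simp: is_inverse_def)
  then show "\<exists>!g'. is_inverse G g g'"
    using ex_inverse[OF assms] by blast
qed

lemma inv_elt_eqI:
  "\<lbrakk>g \<in> carrier G; g' \<in> carrier G; pmult G g g' = Some e; e \<in> identities G\<rbrakk>
    \<Longrightarrow> inv_elt G g = g'"
  using inverse_unique is_inverse_inv_elt by metis

lemma inv_elt_props:
  assumes "g \<in> carrier G"
  shows "inv_elt G g \<in> carrier G"
    and "pmult G (inv_elt G g) g = Some (dom_id G g)"
    and "pmult G g (inv_elt G g) = Some (ran_id G g)"
  using is_inverse_inv_elt[OF assms] by (auto simp: is_inverse_def)

lemma dom_id_inv_elt: "g \<in> carrier G \<Longrightarrow> dom_id G (inv_elt G g) = ran_id G g"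
  using pdefined_iff inv_elt_props pdefinedI by metis

lemma idempotent_identity:
  assumes "g \<in> carrier G" "pmult G g g = Some g"
  shows "g \<in> identities G"
proof -
  note i = inv_elt_props[OF assms(1)]
  \<comment> \<open>Cancel one factor: \<open>g = (g\<^sup>-\<^sup>1 g) g = g\<^sup>-\<^sup>1 (g g) = g\<^sup>-\<^sup>1 g\<close>.\<close>
  obtain z where z: "pmult G (inv_elt G g) g = Some z" "pmult G (dom_id G g) g = Some z"
    using pmult_assoc[OF i(1) assms(1,1) i(2) assms(2)] by metis
  have "z = g"
    using pmult_identity_left[OF dom_id_props(1)[OF assms(1)] assms(1)] z(2) pdefinedI
    by fastforce
  then show ?thesis
    using z(1) i(2) dom_id_props(1)[OF assms(1)] by simp
qed

lemma identity_idempotent: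
  assumes "e \<in> identities G"
  shows "pmult G e e = Some e"
proof -
  note e = identities_carrier[OF assms]
  note d = dom_id_props[OF e]
  have "pmult G e (dom_id G e) = Some (dom_id G e)"
    using pmult_identity_left[OF assms identities_carrier[OF d(1)]] d(2) pdefinedI by metis
  then show ?thesis using d(2) by simp
qed

section \<open>Subgroupoids as groupoids\<close>

lemma subgroupoid_dom_id: "\<lbrakk>subgroupoid S G; g \<in> S\<rbrakk> \<Longrightarrow> dom_id G g \<in> S"
  using inv_elt_props(2)[of g] unfolding subgroupoid_def by blast

lemma subgroupoid_ran_id: "\<lbrakk>subgroupoid S G; g \<in> S\<rbrakk> \<Longrightarrow> ran_id G g \<in> S"
  using inv_elt_props(3)[of g] unfolding subgroupoid_def by blast

lemma identities_restrict:
  assumes "subgroupoid S G"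
  shows "identities (G\<lparr>carrier := S\<rparr>) = identities G \<inter> S"
proof
  have sub: "S \<subseteq> carrier G" using assms by (simp add: subgroupoid_def)
  then show "identities G \<inter> S \<subseteq> identities (G\<lparr>carrier := S\<rparr>)"
    by (auto simp: identities_def pdefined_def)
  show "identities (G\<lparr>carrier := S\<rparr>) \<subseteq> identities G \<inter> S"
  proof
    fix e assume e: "e \<in> identities (G\<lparr>carrier := S\<rparr>)"
    then have eS: "e \<in> S" by (simp add: identities_def)
    then have eG: "e \<in> carrier G" using sub by blast
    note d = dom_id_props[OF eG]
    \<comment> \<open>The domain of \<open>e\<close> lies in \<open>S\<close>, so it may be tested against \<open>e\<close>: both are neutral
      in the product \<open>e d(e)\<close>, hence equal.\<close>
    have "pmult G e (dom_id G e) = Some (dom_id G e)"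
      using e subgroupoid_dom_id[OF assms eS] d(2) by (auto simp: identities_def pdefined_def)
    then show "e \<in> identities G \<inter> S" using d eS by simp
  qed
qed

lemma dom_id_restrict:
  assumes "subgroupoid S G" "g \<in> S"
  shows "\<exists>!e. e \<in> identities (G\<lparr>carrier := S\<rparr>) \<and> pdefined (G\<lparr>carrier := S\<rparr>) g e"
    and "dom_id (G\<lparr>carrier := S\<rparr>) g = dom_id G g"
proof -
  have g: "g \<in> carrier G" using assms subgroupoid_subset by blast
  have iff: "e \<in> identities (G\<lparr>carrier := S\<rparr>) \<and> pdefined (G\<lparr>carrier := S\<rparr>) g e
      \<longleftrightarrow> e = dom_id G g" for e
    unfolding identities_restrict[OF assms(1)]
    using subgroupoid_dom_id[OF assms] dom_id_props[OF g] dom_id_eqI[OF g, of e]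
    by (fastforce simp: pdefined_def)
  show "\<exists>!e. e \<in> identities (G\<lparr>carrier := S\<rparr>) \<and> pdefined (G\<lparr>carrier := S\<rparr>) g e"
    "dom_id (G\<lparr>carrier := S\<rparr>) g = dom_id G g"
    unfolding dom_id_def[of "G\<lparr>carrier := S\<rparr>"] iff by auto
qed

lemma ran_id_restrict:
  assumes "subgroupoid S G" "g \<in> S"
  shows "\<exists>!e. e \<in> identities (G\<lparr>carrier := S\<rparr>) \<and> pdefined (G\<lparr>carrier := S\<rparr>) e g"
    and "ran_id (G\<lparr>carrier := S\<rparr>) g = ran_id G g"
proof -
  have g: "g \<in> carrier G" using assms subgroupoid_subset by blast
  have iff: "e \<in> identities (G\<lparr>carrier := S\<rparr>) \<and> pdefined (G\<lparr>carrier := S\<rparr>) e g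
      \<longleftrightarrow> e = ran_id G g" for e
    unfolding identities_restrict[OF assms(1)]
    using subgroupoid_ran_id[OF assms] ran_id_props[OF g] ran_id_eqI[OF g, of e]
    by (fastforce simp: pdefined_def)
  show "\<exists>!e. e \<in> identities (G\<lparr>carrier := S\<rparr>) \<and> pdefined (G\<lparr>carrier := S\<rparr>) e g"
    "ran_id (G\<lparr>carrier := S\<rparr>) g = ran_id G g"
    unfolding ran_id_def[of "G\<lparr>carrier := S\<rparr>"] iff by auto
qed

lemma groupoid_restrict:
  assumes S: "subgroupoid S G"
  shows "groupoid (G\<lparr>carrier := S\<rparr>)"
proof -
  have sub: "g \<in> carrier G" if "g \<in> S" for g
    using that subgroupoid_subset[OF S] by blast
  show ?thesis
  proof (unfold_locales, goal_cases)
    case (1 g h x)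
    then show ?case using subgroupoid_pmult[OF S, of g h x] by simp
  next
    case (2 g h l)
    then show ?case using assoc[of g h l] sub by (simp add: mult_right3_def mult_left3_def)
  next
    case (3 g h l)
    then show ?case using defined3[of g h l] sub by (simp add: mult_right3_def pdefined_def)
  next
    case (4 g)
    then show ?case using dom_id_restrict(1)[OF S] by simp
  next
    case (5 g)
    then show ?case using ran_id_restrict(1)[OF S] by simp
  next
    case (6 g)
    then have g: "g \<in> S" by simp
    moreover have "inv_elt G g \<in> S" using S g by (rule subgroupoid_inv_elt)
    ultimately have "is_inverse (G\<lparr>carrier := S\<rparr>) g (inv_elt G g)"
      using inv_elt_props[OF sub[OF g]] dom_id_restrict(2)[OF S] ran_id_restrict(2)[OF S]
      by (simp add: is_inverse_def)
    then show ?case by blast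
  qed
qed

lemma subgroupoid_carrier: "carrier G \<noteq> {} \<Longrightarrow> subgroupoid (carrier G) G"
  unfolding subgroupoid_def using inv_elt_props(1) closed by blast

lemma wide_subgroupoid_iff:
  "wide_subgroupoid S G \<longleftrightarrow> subgroupoid S G \<and> identities G \<subseteq> S"
  using identities_restrict by (auto simp: wide_subgroupoid_def)

text \<open>
  The two definedness conditions in a conjugate \<open>g\<^sup>-\<^sup>1 h g\<close> already force \<open>h\<close> into the isotropy group
  at \<open>r(g)\<close>, so conjugates can be described by products alone, which a homomorphism respects.
\<close>

lemma conjugate_set_iff:
  assumes "g \<in> carrier G" "H \<subseteq> carrier G"
  shows "x \<in> conjugate_set G g H \<longleftrightarrow>
    (\<exists>h\<in>H. \<exists>y. pmult G h g \<noteq> None \<and> pmult G (inv_elt G g) h = Some y \<and> pmult G y g = Some x)"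
    (is "?L \<longleftrightarrow> ?R")
proof -
  note i = inv_elt_props[OF assms(1)]
  have iso: "h \<in> isotropy G (ran_id G g) \<longleftrightarrow>
      pmult G h g \<noteq> None \<and> pmult G (inv_elt G g) h \<noteq> None" if "h \<in> H" for h
  proof -
    have h: "h \<in> carrier G" using that assms(2) by blast
    show ?thesis
      using pdefined_iff[OF h assms(1)] pdefined_iff[OF i(1) h] dom_id_inv_elt[OF assms(1)] h
      unfolding isotropy_def pdefined_def by auto
  qed
  show ?thesis
  proof
    assume ?L
    then show ?R
      using iso by (fastforce simp: conjugate_set_def mult_left3_def bind_eq_Some_conv)
  next
    assume ?R
    then show ?L
      using iso by (fastforce simp: conjugate_set_def mult_left3_def bind_eq_Some_conv)
  qed
qed

end

section \<open>Strong homomorphisms\<close>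

locale strong_groupoid_hom = source: groupoid G + target: groupoid G'
  for G :: "('a, 'm) pmagma_scheme" and G' :: "('b, 'n) pmagma_scheme" +
  fixes \<phi> :: "'a \<Rightarrow> 'b"
  assumes strong: "strong_hom G G' \<phi>"
begin

lemma hom_carrier: "g \<in> carrier G \<Longrightarrow> \<phi> g \<in> carrier G'"
  using strong by (auto simp: strong_hom_def groupoid_hom_def)

lemma hom_pmult:
  "\<lbrakk>g \<in> carrier G; h \<in> carrier G; pmult G g h = Some x\<rbrakk> \<Longrightarrow> pmult G' (\<phi> g) (\<phi> h) = Some (\<phi> x)"
  using strong by (auto simp: strong_hom_def groupoid_hom_def)

lemma hom_reflect:
  assumes "g \<in> carrier G" "h \<in> carrier G" "pmult G' (\<phi> g) (\<phi> h) = Some y"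
  obtains x where "pmult G g h = Some x" "y = \<phi> x"
proof -
  have "pdefined G g h"
    using strong assms by (auto simp: strong_hom_def pdefined_def)
  then obtain x where "pmult G g h = Some x" by (auto simp: pdefined_def)
  then show thesis using hom_pmult assms that by fastforce
qed

text \<open>
  Idempotents are exactly the identities, and a homomorphism preserves idempotents.
\<close>

lemma hom_identity: "e \<in> identities G \<Longrightarrow> \<phi> e \<in> identities G'"
  using target.idempotent_identity source.identity_idempotent hom_pmult hom_carrier
    identities_carrier by metis

lemma hom_inv_elt: "g \<in> carrier G \<Longrightarrow> \<phi> (inv_elt G g) = inv_elt G' (\<phi> g)"
  using target.inv_elt_eqI[of "\<phi> g" "\<phi> (inv_elt G g)" "\<phi> (ran_id G g)"] hom_carrier
    hom_pmult hom_identity source.inv_elt_props source.ran_id_props by metis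

lemma identities_subset_Ker: "identities G \<subseteq> Ker G G' \<phi>"
  using hom_identity identities_carrier by (auto simp: Ker_def)

lemma Ker_pmult_image:
  assumes "k \<in> Ker G G' \<phi>" "h \<in> carrier G" "pmult G k h = Some x"
  shows "\<phi> x = \<phi> h"
proof -
  have "pmult G' (\<phi> k) (\<phi> h) = Some (\<phi> x)"
    using assms hom_pmult by (auto simp: Ker_def)
  then show ?thesis
    using pmult_identity_left[of "\<phi> k" G' "\<phi> h"] assms(1,2) hom_carrier pdefinedI
    by (fastforce simp: Ker_def)
qed

text \<open>
  The quotient \<open>k = g h\<^sup>-\<^sup>1\<close> exists because its image \<open>\<phi> g (\<phi> h)\<^sup>-\<^sup>1 = \<phi> h (\<phi> h)\<^sup>-\<^sup>1\<close> does; this is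
  where strength of \<open>\<phi>\<close> enters.
\<close>

lemma same_image_Ker:
  assumes g: "g \<in> carrier G" and h: "h \<in> carrier G" and eq: "\<phi> g = \<phi> h"
  obtains k where "k \<in> Ker G G' \<phi>" "pmult G k h = Some g"
proof -
  note i = source.inv_elt_props[OF h]
  have "pmult G' (\<phi> g) (\<phi> (inv_elt G h)) = Some (\<phi> (ran_id G h))"
    using hom_pmult[OF h i(1) i(3)] eq by simp
  then obtain k where k: "pmult G g (inv_elt G h) = Some k" "\<phi> k = \<phi> (ran_id G h)"
    using hom_reflect[OF g i(1)] by metis
  have kc: "k \<in> carrier G" using source.closed[OF g i(1) k(1)] .
  have ker: "k \<in> Ker G G' \<phi>"
    using kc k(2) hom_identity[OF source.ran_id_props(1)[OF h]] by (simp add: Ker_def)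
  obtain z where z: "pmult G g (dom_id G h) = Some z" "pmult G k h = Some z"
    using source.pmult_assoc[OF g i(1) h k(1) i(2)] by metis
  have "z = g"
    using pmult_identity_right[OF source.dom_id_props(1)[OF h] g] z(1) pdefinedI by fastforce
  then show thesis using that ker z(2) by simp
qed

lemma subgroupoid_image:
  assumes "subgroupoid H G"
  shows "subgroupoid (\<phi> ` H) G'"
proof -
  have H: "H \<subseteq> carrier G" "H \<noteq> {}" "\<And>h. h \<in> H \<Longrightarrow> inv_elt G h \<in> H"
    "\<And>h k x. \<lbrakk>h \<in> H; k \<in> H; pmult G h k = Some x\<rbrakk> \<Longrightarrow> x \<in> H"
    using assms unfolding subgroupoid_def by blast+
  have "y \<in> \<phi> ` H" if hk: "h \<in> H" "k \<in> H" and y: "pmult G' (\<phi> h) (\<phi> k) = Some y" for h k y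
  proof -
    have "h \<in> carrier G" "k \<in> carrier G" using hk H(1) by blast+
    then obtain x where "pmult G h k = Some x" "y = \<phi> x"
      using y by (rule hom_reflect)
    then show ?thesis using H(4)[OF hk] by blast
  qed
  moreover have "inv_elt G' (\<phi> h) \<in> \<phi> ` H" if "h \<in> H" for h
    using hom_inv_elt[of h] H(1) H(3)[OF that] that by (metis imageI subsetD)
  ultimately show ?thesis
    using H(1,2) hom_carrier unfolding subgroupoid_def by blast
qed

lemma subgroupoid_inverse_image:
  assumes "subgroupoid H' G'" and "H' \<inter> \<phi> ` carrier G \<noteq> {}"
  shows "subgroupoid (inverse_image G \<phi> H') G"
  unfolding subgroupoid_def
proof (intro conjI ballI allI impI)
  show "inverse_image G \<phi> H' \<subseteq> carrier G" "inverse_image G \<phi> H' \<noteq> {}"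
    using assms(2) by (auto simp: inverse_image_def)
next
  fix h assume "h \<in> inverse_image G \<phi> H'"
  then show "inv_elt G h \<in> inverse_image G \<phi> H'"
    using subgroupoid_inv_elt[OF assms(1)] hom_inv_elt source.inv_elt_props(1)
    by (simp add: inverse_image_def)
next
  fix h k x
  assume "h \<in> inverse_image G \<phi> H'" "k \<in> inverse_image G \<phi> H'" "pmult G h k = Some x"
  then show "x \<in> inverse_image G \<phi> H'"
    using subgroupoid_pmult[OF assms(1)] hom_pmult source.closed
    unfolding inverse_image_def by blast
qed

lemma Ker_prod_eq_inverse_image:
  assumes "H \<subseteq> carrier G"
  shows "set_prod G (Ker G G' \<phi>) H = inverse_image G \<phi> (\<phi> ` H)"
proof
  show "set_prod G (Ker G G' \<phi>) H \<subseteq> inverse_image G \<phi> (\<phi> ` H)"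
  proof
    fix x assume "x \<in> set_prod G (Ker G G' \<phi>) H"
    then obtain k h where kh: "k \<in> Ker G G' \<phi>" "h \<in> H" "pmult G k h = Some x"
      by (auto simp: set_prod_def)
    then have "\<phi> x = \<phi> h" using Ker_pmult_image assms by blast
    moreover have "x \<in> carrier G"
      using source.closed kh assms by (auto simp: Ker_def)
    ultimately show "x \<in> inverse_image G \<phi> (\<phi> ` H)"
      using kh(2) by (simp add: inverse_image_def)
  qed
next
  show "inverse_image G \<phi> (\<phi> ` H) \<subseteq> set_prod G (Ker G G' \<phi>) H"
  proof
    fix g assume "g \<in> inverse_image G \<phi> (\<phi> ` H)"
    then obtain h where h: "g \<in> carrier G" "h \<in> H" "\<phi> g = \<phi> h"
      by (auto simp: inverse_image_def)
    then obtain k where "k \<in> Ker G G' \<phi>" "pmult G k h = Some g"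
      using same_image_Ker assms by blast
    then show "g \<in> set_prod G (Ker G G' \<phi>) H"
      using h(2) by (auto simp: set_prod_def)
  qed
qed

lemma subgroupoid_Ker_prod:
  assumes "subgroupoid H G"
  shows "subgroupoid (set_prod G (Ker G G' \<phi>) H) G"
proof -
  have "H \<subseteq> carrier G" "H \<noteq> {}"
    using assms by (rule subgroupoid_subset, rule subgroupoid_nonempty)
  then show ?thesis
    using subgroupoid_inverse_image[OF subgroupoid_image[OF assms]]
    by (auto simp: Ker_prod_eq_inverse_image)
qed

lemma inverse_image_image:
  assumes "subgroupoid H G" "Ker G G' \<phi> \<subseteq> H"
  shows "inverse_image G \<phi> (\<phi> ` H) = H"
proof
  have sub: "H \<subseteq> carrier G" using assms(1) by (simp add: subgroupoid_def)
  show "inverse_image G \<phi> (\<phi> ` H) \<subseteq> H"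
    using subgroupoid_pmult[OF assms(1)] assms(2)
    unfolding Ker_prod_eq_inverse_image[OF sub, symmetric] set_prod_def by blast
  show "H \<subseteq> inverse_image G \<phi> (\<phi> ` H)"
    using sub by (auto simp: inverse_image_def)
qed

lemma inj_iff_Ker: "inj_on \<phi> (carrier G) \<longleftrightarrow> Ker G G' \<phi> = identities G"
proof
  assume inj: "inj_on \<phi> (carrier G)"
  have "g \<in> identities G" if g: "g \<in> Ker G G' \<phi>" for g
  proof -
    have gc: "g \<in> carrier G" using g by (simp add: Ker_def)
    \<comment> \<open>The image of \<open>g\<close> is an identity, hence idempotent; strength and injectivity pull this back.\<close>
    have "pmult G' (\<phi> g) (\<phi> g) = Some (\<phi> g)"
      using g target.identity_idempotent by (simp add: Ker_def)
    then obtain x where x: "pmult G g g = Some x" "\<phi> g = \<phi> x"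
      using hom_reflect[OF gc gc] by metis
    then have "x = g"
      using inj_onD[OF inj x(2)] source.closed[OF gc gc x(1)] gc by simp
    then show ?thesis using source.idempotent_identity gc x(1) by simp
  qed
  then show "Ker G G' \<phi> = identities G" using identities_subset_Ker by blast
next
  assume ker: "Ker G G' \<phi> = identities G"
  show "inj_on \<phi> (carrier G)"
  proof (rule inj_onI)
    fix g h assume gh: "g \<in> carrier G" "h \<in> carrier G" "\<phi> g = \<phi> h"
    then obtain k where "k \<in> identities G" "pmult G k h = Some g"
      using same_image_Ker ker by metis
    then show "g = h"
      using pmult_identity_left[of k G h] gh(2) pdefinedI by fastforce
  qed
qed

lemma image_conjugate_set:
  assumes g: "g \<in> carrier G" and H: "H \<subseteq> carrier G"
  shows "\<phi> ` conjugate_set G g H = conjugate_set G' (\<phi> g) (\<phi> ` H)"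
proof -
  have H': "\<phi> ` H \<subseteq> carrier G'" using H hom_carrier by blast
  note conj = source.conjugate_set_iff[OF g H]
  note conj' = target.conjugate_set_iff[OF hom_carrier[OF g] H']
  note i = source.inv_elt_props(1)[OF g]
  show ?thesis
  proof (intro equalityI subsetI)
    fix x' assume "x' \<in> \<phi> ` conjugate_set G g H"
    then obtain x where x: "x' = \<phi> x" "x \<in> conjugate_set G g H" by blast
    then obtain h y w where h: "h \<in> H" "pmult G h g = Some w"
      "pmult G (inv_elt G g) h = Some y" "pmult G y g = Some x"
      unfolding conj by blast
    have hc: "h \<in> carrier G" using h(1) H by blast
    show "x' \<in> conjugate_set G' (\<phi> g) (\<phi> ` H)"
      unfolding conj'
      using h(1) x(1) hom_pmult[OF hc g h(2)] hom_pmult[OF i hc h(3)] hom_inv_elt[OF g]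
        hom_pmult[OF source.closed[OF i hc h(3)] g h(4)] by auto
  next
    fix x' assume "x' \<in> conjugate_set G' (\<phi> g) (\<phi> ` H)"
    then obtain h y' w' where h: "h \<in> H" "pmult G' (\<phi> h) (\<phi> g) = Some w'"
      "pmult G' (\<phi> (inv_elt G g)) (\<phi> h) = Some y'" "pmult G' y' (\<phi> g) = Some x'"
      unfolding conj' hom_inv_elt[OF g] by blast
    have hc: "h \<in> carrier G" using h(1) H by blast
    obtain w where w: "pmult G h g = Some w"
      using hom_reflect[OF hc g h(2)] by metis
    obtain y where y: "pmult G (inv_elt G g) h = Some y" "y' = \<phi> y"
      using hom_reflect[OF i hc h(3)] by metis
    obtain x where x: "pmult G y g = Some x" "x' = \<phi> x"
      using hom_reflect[OF source.closed[OF i hc y(1)] g] h(4) y(2) by metis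
    have "x \<in> conjugate_set G g H" unfolding conj using h(1) w y(1) x(1) by auto
    then show "x' \<in> \<phi> ` conjugate_set G g H" using x(2) by blast
  qed
qed

section \<open>Correspondence for surjective strong homomorphisms\<close>

lemma normal_image:
  assumes surj: "\<phi> ` carrier G = carrier G'" and "normal_subgroupoid H G"
  shows "normal_subgroupoid (\<phi> ` H) G'"
proof -
  have H: "subgroupoid H G" "H \<subseteq> carrier G"
    "\<And>g. g \<in> carrier G \<Longrightarrow> conjugate_set G g H \<noteq> {} \<and> conjugate_set G g H \<subseteq> H"
    using assms(2) subgroupoid_subset[of H G] unfolding normal_subgroupoid_def by blast+
  have "conjugate_set G' (\<phi> g) (\<phi> ` H) \<noteq> {} \<and> conjugate_set G' (\<phi> g) (\<phi> ` H) \<subseteq> \<phi> ` H"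
    if "g \<in> carrier G" for g
    using H(3)[OF that] unfolding image_conjugate_set[OF that H(2), symmetric] by blast
  then show ?thesis
    using subgroupoid_image[OF H(1)] surj[symmetric] by (simp add: normal_subgroupoid_def)
qed

lemma normal_image_iff:
  assumes surj: "\<phi> ` carrier G = carrier G'" and H: "subgroupoid H G" and "Ker G G' \<phi> \<subseteq> H"
  shows "normal_subgroupoid (\<phi> ` H) G' \<longleftrightarrow> normal_subgroupoid H G"
proof
  assume N: "normal_subgroupoid (\<phi> ` H) G'"
  have sub: "H \<subseteq> carrier G" using H by (simp add: subgroupoid_def)
  have "conjugate_set G g H \<noteq> {} \<and> conjugate_set G g H \<subseteq> H" if g: "g \<in> carrier G" for g
  proof -
    have c: "\<phi> ` conjugate_set G g H \<noteq> {}" "\<phi> ` conjugate_set G g H \<subseteq> \<phi> ` H"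
      using N hom_carrier[OF g] unfolding image_conjugate_set[OF g sub]
      by (auto simp: normal_subgroupoid_def)
    \<comment> \<open>A conjugate is an element of \<open>G\<close> with image in \<open>\<phi>(H)\<close>, and \<open>H\<close> is saturated.\<close>
    have "x \<in> carrier G" if "x \<in> conjugate_set G g H" for x
      using that source.closed g sub source.inv_elt_props(1)[OF g]
      unfolding source.conjugate_set_iff[OF g sub] by blast
    then have "conjugate_set G g H \<subseteq> inverse_image G \<phi> (\<phi> ` H)"
      using c(2) by (auto simp: inverse_image_def)
    then show ?thesis using c(1) inverse_image_image[OF H assms(3)] by auto
  qed
  then show "normal_subgroupoid H G" using H by (simp add: normal_subgroupoid_def)
qed (rule normal_image[OF surj])

lemma wide_image:
  assumes surj: "\<phi> ` carrier G = carrier G'" and "subgroupoid H G" "Ker G G' \<phi> \<subseteq> H"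
  shows "wide_subgroupoid (\<phi> ` H) G'"
proof -
  have "e \<in> \<phi> ` H" if e: "e \<in> identities G'" for e
  proof -
    obtain g where "g \<in> carrier G" "e = \<phi> g"
      using identities_carrier[OF e] surj by blast
    then show ?thesis using e assms(3) by (auto simp: Ker_def)
  qed
  then show ?thesis
    using subgroupoid_image[OF assms(2)] target.wide_subgroupoid_iff by blast
qed

lemma image_inverse_image:
  "\<lbrakk>\<phi> ` carrier G = carrier G'; H' \<subseteq> carrier G'\<rbrakk> \<Longrightarrow> \<phi> ` inverse_image G \<phi> H' = H'"
  by (fastforce simp: inverse_image_def)

lemma Ker_subset_inverse_image:
  "wide_subgroupoid H' G' \<Longrightarrow> Ker G G' \<phi> \<subseteq> inverse_image G \<phi> H'"
  using target.wide_subgroupoid_iff by (auto simp: Ker_def inverse_image_def)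

lemma bij_betw_wide_subgroupoids:
  assumes surj: "\<phi> ` carrier G = carrier G'"
  shows "bij_betw ((`) \<phi>) {H. subgroupoid H G \<and> Ker G G' \<phi> \<subseteq> H} {H'. wide_subgroupoid H' G'}"
proof (rule bij_betw_byWitness[where f' = "inverse_image G \<phi>"])
  have sub: "H' \<subseteq> carrier G'" "H' \<noteq> {}" "subgroupoid H' G'" if "wide_subgroupoid H' G'" for H'
    using that subgroupoid_subset[of H' G'] subgroupoid_nonempty[of H' G']
    unfolding wide_subgroupoid_def by blast+
  show "\<forall>H\<in>{H. subgroupoid H G \<and> Ker G G' \<phi> \<subseteq> H}. inverse_image G \<phi> (\<phi> ` H) = H"
    using inverse_image_image by blast
  show "\<forall>H'\<in>{H'. wide_subgroupoid H' G'}. \<phi> ` inverse_image G \<phi> H' = H'"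
    using image_inverse_image[OF surj] sub(1) by blast
  show "(`) \<phi> ` {H. subgroupoid H G \<and> Ker G G' \<phi> \<subseteq> H} \<subseteq> {H'. wide_subgroupoid H' G'}"
    using wide_image[OF surj] by blast
  have "subgroupoid (inverse_image G \<phi> H') G" if "wide_subgroupoid H' G'" for H'
    using subgroupoid_inverse_image[of H'] sub[OF that] surj by blast
  then show "inverse_image G \<phi> ` {H'. wide_subgroupoid H' G'}
      \<subseteq> {H. subgroupoid H G \<and> Ker G G' \<phi> \<subseteq> H}"
    using Ker_subset_inverse_image by blast
qed

section \<open>Corestriction to the image\<close>

lemma subgroupoid_range: "carrier G \<noteq> {} \<Longrightarrow> subgroupoid (\<phi> ` carrier G) G'"
  using subgroupoid_image source.subgroupoid_carrier by blast

lemma strong_groupoid_hom_image: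
  "strong_groupoid_hom G (image_groupoid G G' \<phi>) \<phi>"
proof -
  have "groupoid (image_groupoid G G' \<phi>)"
  proof (cases "carrier G = {}")
    \<comment> \<open>Subgroupoids are nonempty by definition, so the empty image is a groupoid for another
      reason: every axiom quantifies over its elements.\<close>
    case True
    then show ?thesis by unfold_locales (auto simp: image_groupoid_def)
  next
    case False
    then show ?thesis
      using target.groupoid_restrict[OF subgroupoid_range] by (simp add: image_groupoid_def)
  qed
  moreover have "strong_hom G (image_groupoid G G' \<phi>) \<phi>"
    using strong
    by (auto simp: strong_hom_def groupoid_hom_def image_groupoid_def pdefined_def)
  ultimately show ?thesis
    by (intro strong_groupoid_hom.intro strong_groupoid_hom_axioms.intro
        source.groupoid_axioms)
qed

lemma Ker_image_groupoid: "Ker G (image_groupoid G G' \<phi>) \<phi> = Ker G G' \<phi>"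
proof (cases "carrier G = {}")
  case True
  then show ?thesis by (simp add: Ker_def)
next
  case False
  then show ?thesis
    using target.identities_restrict[OF subgroupoid_range]
    by (auto simp: Ker_def image_groupoid_def)
qed

end

theorem proposition3p14:
  fixes G :: "('a, 'm) pmagma_scheme" and G' :: "('b, 'n) pmagma_scheme"
    and \<phi> :: "'a \<Rightarrow> 'b"
  assumes "groupoid G" and "groupoid G'" and "strong_hom G G' \<phi>"
  shows
    "(\<forall>H. subgroupoid H G \<longrightarrow>
        subgroupoid (\<phi> ` H) G' \<and>
        set_prod G (Ker G G' \<phi>) H = inverse_image G \<phi> (\<phi> ` H) \<and>
        subgroupoid (set_prod G (Ker G G' \<phi>) H) G) \<and>
     (carrier G \<noteq> {} \<longrightarrow> subgroupoid (\<phi> ` carrier G) G') \<and>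
     (\<forall>H. normal_subgroupoid H G \<longrightarrow>
        normal_subgroupoid (\<phi> ` H) (image_groupoid G G' \<phi>)) \<and>
     (groupoid_hom G G' \<phi> \<and> inj_on \<phi> (carrier G) \<longleftrightarrow> Ker G G' \<phi> = identities G) \<and>
     (\<exists>F. bij_betw F {H. subgroupoid H G \<and> Ker G G' \<phi> \<subseteq> H}
                     {H'. wide_subgroupoid H' (image_groupoid G G' \<phi>)} \<and>
          (\<forall>H. subgroupoid H G \<and> Ker G G' \<phi> \<subseteq> H \<longrightarrow>
             F H = \<phi> ` H \<and>
             (normal_subgroupoid H G \<longleftrightarrow>
              normal_subgroupoid (F H) (image_groupoid G G' \<phi>))))"
proof -
  interpret strong_groupoid_hom G G' \<phi>
    using assms by (intro strong_groupoid_hom.intro strong_groupoid_hom_axioms.intro)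
  interpret im: strong_groupoid_hom G "image_groupoid G G' \<phi>" \<phi>
    by (rule strong_groupoid_hom_image)
  have surj: "\<phi> ` carrier G = carrier (image_groupoid G G' \<phi>)"
    by (simp add: image_groupoid_def)
  have hom: "groupoid_hom G G' \<phi>"
    using strong by (simp add: strong_hom_def)
  show ?thesis
  proof (intro conjI exI[of _ "(`) \<phi>"])
    show "\<forall>H. subgroupoid H G \<longrightarrow>
        subgroupoid (\<phi> ` H) G' \<and>
        set_prod G (Ker G G' \<phi>) H = inverse_image G \<phi> (\<phi> ` H) \<and>
        subgroupoid (set_prod G (Ker G G' \<phi>) H) G"
      using subgroupoid_image Ker_prod_eq_inverse_image subgroupoid_Ker_prod
        subgroupoid_subset[of _ G] by blast
    show "carrier G \<noteq> {} \<longrightarrow> subgroupoid (\<phi> ` carrier G) G'"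
      using subgroupoid_range by blast
    show "\<forall>H. normal_subgroupoid H G \<longrightarrow>
        normal_subgroupoid (\<phi> ` H) (image_groupoid G G' \<phi>)"
      using im.normal_image[OF surj] by blast
    show "groupoid_hom G G' \<phi> \<and> inj_on \<phi> (carrier G) \<longleftrightarrow> Ker G G' \<phi> = identities G"
      using hom inj_iff_Ker by blast
    show "bij_betw ((`) \<phi>) {H. subgroupoid H G \<and> Ker G G' \<phi> \<subseteq> H}
        {H'. wide_subgroupoid H' (image_groupoid G G' \<phi>)}"
      using im.bij_betw_wide_subgroupoids[OF surj] by (simp add: Ker_image_groupoid)
    show "\<forall>H. subgroupoid H G \<and> Ker G G' \<phi> \<subseteq> H \<longrightarrow>
        \<phi> ` H = \<phi> ` H \<and>
        (normal_subgroupoid H G \<longleftrightarrow>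
         normal_subgroupoid (\<phi> ` H) (image_groupoid G G' \<phi>))"
      using im.normal_image_iff[OF surj] by (simp add: Ker_image_groupoid)
  qed
qed

end
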